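(* Let $\lambda\in\mathbb{C}$ with $\lambda\neq 1$, and let $(S_n(x|\lambda))_{n\ge 0}$ be the associated sequence for the delta series $\frac{1-\lambda}{e^t-\lambda}\,t$, i.e. $S_n(x|\lambda)\sim\left(1,\frac{1-\lambda}{e^t-\lambda}t\right)$. Then for every integer $n\ge 0$, $$S_n(x|\lambda)=\frac{x}{(1-\lambda)^n}\sum_{l=0}^{n}\binom{n}{l}(-\lambda)^{n-l}(x+l)^{n-1},$$ where for $n=0$ the right-hand side is read as $x\cdot x^{-1}=1$.
   Context: Let $\mathbb{P}=\mathbb{C}[x]$ and let $\mathcal{F}$ be the algebra of formal power series in $t$ over $\mathbb{C}$. A series $f(t)=\sum_{k\ge0}\frac{a_k}{k!}t^k\in\mathcal{F}$ acts as a linear functional on $\mathbb{P}$ by $\langle f(t)\mid x^n\rangle=a_n$ for $n\ge0$. A delta series is a series with zero constant term and nonzero coefficient of $t$; an invertible series is one with nonzero constant term. For an invertible series $g(t)$ and a delta series $f(t)$ there is a unique sequence of polynomials $S_n(x)$ ($n\ge0$) with $\langle g(t)f(t)^k\mid S_n(x)\rangle=n!\,\delta_{n,k}$ for all $n,k\ge0$; it is called the Sheffer sequence for $(g(t),f(t))$, written $S_n(x)\sim(g(t),f(t))$. If $g(t)=1$, it is called the associated sequence for $f(t)$. Convention: $(-\lambda)^0=1$. *)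

theory Defs
  imports Complex_Main "HOL-Computational_Algebra.Computational_Algebra"
begin

definition delta_series :: "complex fps \<Rightarrow> bool" where
  "delta_series f \<longleftrightarrow> fps_nth f 0 = 0 \<and> fps_nth f 1 \<noteq> 0"

definition invertible_series :: "complex fps \<Rightarrow> bool" where
  "invertible_series g \<longleftrightarrow> fps_nth g 0 \<noteq> 0"

text \<open>
  The pairing \<open>\<langle>f(t) | p(x)\<rangle>\<close>: the linear functional on polynomials that sends \<open>x ^ k\<close> to
  \<open>a\<^sub>k\<close>, where \<open>f(t) = \<Sum>k. (a\<^sub>k / k!) t ^ k\<close>, so that \<open>a\<^sub>k = k! * fps_nth f k\<close>.
\<close>

definition umbral_pairing :: "complex fps \<Rightarrow> complex poly \<Rightarrow> complex" where
  "umbral_pairing f p = (\<Sum>k\<le>degree p. coeff p k * (fact k * fps_nth f k))"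

definition sheffer_seq :: "complex fps \<Rightarrow> complex fps \<Rightarrow> (nat \<Rightarrow> complex poly) \<Rightarrow> bool" where
  "sheffer_seq g f S \<longleftrightarrow> invertible_series g \<and> delta_series f \<and>
     (\<forall>n k. umbral_pairing (g * f ^ k) (S n) = (if n = k then fact n else 0))"

definition associated_seq :: "complex fps \<Rightarrow> (nat \<Rightarrow> complex poly) \<Rightarrow> bool" where
  "associated_seq f S \<longleftrightarrow> sheffer_seq 1 f S"

lemma umbral_pairing_bound:
  assumes "degree p \<le> N"
  shows "umbral_pairing f p = (\<Sum>k\<le>N. coeff p k * (fact k * fps_nth f k))"
  unfolding umbral_pairing_def
  using assms by (intro sum.mono_neutral_left) (auto simp: coeff_eq_0)

lemma umbral_pairing_monom: "umbral_pairing f (monom 1 n) = fact n * fps_nth f n"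
  by (subst umbral_pairing_bound[where N = n])
     (auto simp: degree_monom_eq if_distrib[of "\<lambda>c. c * _"] cong: if_cong)

lemma umbral_pairing_add: "umbral_pairing f (p + q) = umbral_pairing f p + umbral_pairing f q"
proof -
  define N where "N = max (degree p) (degree q)"
  have "degree (p + q) \<le> N" "degree p \<le> N" "degree q \<le> N"
    by (auto simp: N_def degree_add_le_max)
  then show ?thesis
    by (simp add: umbral_pairing_bound[where N = N] sum.distrib algebra_simps)
qed

lemma umbral_pairing_smult: "umbral_pairing f (smult c p) = c * umbral_pairing f p"
  by (subst umbral_pairing_bound[where N = "degree p"])
     (auto simp: umbral_pairing_def sum_distrib_left mult.assoc degree_smult_le)

lemma umbral_pairing_diff: "umbral_pairing f (p - q) = umbral_pairing f p - umbral_pairing f q"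
  using umbral_pairing_add[of f "p - q" q] by simp

lemma sheffer_nth_below:
  assumes "delta_series f" "j < k"
  shows "fps_nth (g * f ^ k) j = 0"
proof -
  have "fps_nth (f ^ k) i = 0" if "i < k" for i
    using assms that startsby_zero_power_prefix[of f k] by (auto simp: delta_series_def)
  with assms(2) show ?thesis
    by (auto simp: fps_mult_nth intro!: sum.neutral)
qed

lemma sheffer_nth_diag:
  assumes "invertible_series g" "delta_series f"
  shows "fps_nth (g * f ^ k) k \<noteq> 0"
proof -
  have "fps_nth (f ^ k) i = 0" if "i < k" for i
    using assms that startsby_zero_power_prefix[of f k] by (auto simp: delta_series_def)
  then have "fps_nth (g * f ^ k) k = (\<Sum>i\<in>{0}. fps_nth g i * fps_nth (f ^ k) (k - i))"
    unfolding fps_mult_nth by (intro sum.mono_neutral_right) auto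
  moreover have "fps_nth (f ^ k) k = fps_nth f 1 ^ k"
    using assms(2) startsby_zero_power_nth_same[of f k] by (simp add: delta_series_def)
  ultimately show ?thesis
    using assms by (simp add: invertible_series_def delta_series_def)
qed

lemma umbral_pairing_sheffer_above:
  assumes "delta_series f" "degree p < k"
  shows "umbral_pairing (g * f ^ k) p = 0"
  unfolding umbral_pairing_def
  using assms sheffer_nth_below by (intro sum.neutral) auto

lemma umbral_pairing_sheffer_eq_0:
  assumes "invertible_series g" "delta_series f"
    and zero: "\<And>k. umbral_pairing (g * f ^ k) p = 0"
  shows "p = 0"
proof (rule ccontr)
  assume "p \<noteq> 0"
  let ?n = "degree p"
  have "umbral_pairing (g * f ^ ?n) p =
      (\<Sum>k\<in>{?n}. coeff p k * (fact k * fps_nth (g * f ^ ?n) k))"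
    unfolding umbral_pairing_def
    using sheffer_nth_below[OF assms(2)] by (intro sum.mono_neutral_right) auto
  with zero[of ?n] sheffer_nth_diag[OF assms(1,2), of ?n] \<open>p \<noteq> 0\<close> show False
    by simp
qed

lemma umbral_pairing_sheffer_solve:
  assumes "invertible_series g" "delta_series f"
  shows "\<exists>p. degree p \<le> n \<and> (\<forall>k\<le>n. umbral_pairing (g * f ^ k) p = c k)"
proof (induction n arbitrary: c)
  case 0
  let ?p = "smult (c 0 / fps_nth g 0) (monom 1 0)"
  have "umbral_pairing (g * f ^ 0) ?p = c 0"
    using assms(1) by (simp only: umbral_pairing_smult umbral_pairing_monom)
      (simp add: invertible_series_def)
  then show ?case
    by (intro exI[of _ ?p]) (simp add: monom_0)
next
  case (Suc n)
  let ?N = "Suc n"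
  define a where "a = c ?N / (fact ?N * fps_nth (g * f ^ ?N) ?N)"
  let ?q = "smult a (monom 1 ?N)"
  obtain p where p: "degree p \<le> n"
    "\<And>k. k \<le> n \<Longrightarrow> umbral_pairing (g * f ^ k) p = c k - umbral_pairing (g * f ^ k) ?q"
    using Suc[of "\<lambda>k. c k - umbral_pairing (g * f ^ k) ?q"] by blast
  have "fact ?N * fps_nth (g * f ^ ?N) ?N \<noteq> 0"
    using sheffer_nth_diag[OF assms, of ?N] fact_nonzero[of ?N] by (metis mult_eq_0_iff)
  then have top: "umbral_pairing (g * f ^ ?N) ?q = c ?N"
    by (simp only: umbral_pairing_smult umbral_pairing_monom a_def nonzero_divide_eq_eq[symmetric])
       (metis nonzero_eq_divide_eq)
  have "degree ?q \<le> ?N"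
    by (rule order.trans[OF degree_smult_le degree_monom_le])
  with p(1) have "degree (p + ?q) \<le> ?N"
    by (intro degree_add_le) auto
  moreover have "umbral_pairing (g * f ^ k) (p + ?q) = c k" if "k \<le> ?N" for k
  proof (cases "k = ?N")
    case True
    have "umbral_pairing (g * f ^ ?N) p = 0"
      by (rule umbral_pairing_sheffer_above) (use assms p(1) in auto)
    then show ?thesis using True top by (simp only: umbral_pairing_add) simp
  next
    case False
    then have "k \<le> n" using that by simp
    then show ?thesis by (simp only: umbral_pairing_add p(2)) simp
  qed
  ultimately show ?case by blast
qed

theorem sheffer_seq_ex1:
  assumes "invertible_series g" "delta_series f"
  shows "\<exists>!S. sheffer_seq g f S"
proof -
  have "\<exists>p. \<forall>k. umbral_pairing (g * f ^ k) p = (if n = k then fact n else 0)" for n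
  proof -
    obtain p where p: "degree p \<le> n"
      "\<And>k. k \<le> n \<Longrightarrow> umbral_pairing (g * f ^ k) p = (if n = k then fact n else 0)"
      using umbral_pairing_sheffer_solve[OF assms, of n "\<lambda>k. if n = k then fact n else 0"] by blast
    have "umbral_pairing (g * f ^ k) p = (if n = k then fact n else 0)" for k
    proof (cases "k \<le> n")
      case False
      then show ?thesis
        using umbral_pairing_sheffer_above[OF assms(2), of p k g] p(1) by auto
    qed (rule p(2))
    then show ?thesis by blast
  qed
  then obtain S where "sheffer_seq g f S"
    using assms unfolding sheffer_seq_def by metis
  moreover have "S' = S''" if "sheffer_seq g f S'" "sheffer_seq g f S''" for S' S''
  proof
    fix n
    have "S' n - S'' n = 0"
      by (rule umbral_pairing_sheffer_eq_0[OF assms])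
         (use that in \<open>simp add: sheffer_seq_def umbral_pairing_diff\<close>)
    then show "S' n = S'' n" by simp
  qed
  ultimately show ?thesis by blast
qed

end

theory Submission
  imports Defs
begin

text \<open>
  The formula is the transfer formula of umbral calculus. Write the delta series as \<open>f = t / h\<close>
  with \<open>h = (e\<^sup>t - \<lambda>) / (1 - \<lambda>)\<close>. A series acts on polynomials as an operator, with \<open>t\<close> acting as
  differentiation, so that \<open>e\<^bsup>lt\<^esup>\<close> acts as the shift \<open>x \<mapsto> x + l\<close>. Expanding \<open>(e\<^sup>t - \<lambda>)\<^sup>n\<close> by the
  binomial theorem therefore identifies the claimed polynomial, for \<open>n > 0\<close>, with
  \<open>x \<cdot> h(t)\<^sup>n x\<^bsup>n-1\<^esup>\<close>.

  Under the pairing, multiplication by \<open>x\<close> is adjoint to the derivative with respect to \<open>t\<close>, and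
  \<open>h(t)\<^sup>n\<close> is adjoint to multiplication by \<open>h\<^sup>n\<close>. Pairing the polynomial with \<open>f\<^sup>k\<close> thus gives
  \<open>(n - 1)!\<close> times the coefficient of \<open>t\<^bsup>n-1\<^esup>\<close> in \<open>(f\<^sup>k)' h\<^sup>n\<close>. That this coefficient is
  \<open>n \<delta>\<^bsub>n,k\<^esub>\<close> is a form of Lagrange inversion (\<open>lagrange_coefficient\<close>), valid for every \<open>h\<close>
  with nonzero constant term. So the polynomial satisfies the equations that define \<open>S\<^sub>n\<close>,
  and these determine it.
\<close>

text \<open>
  This is the formal version of the fact that \<open>(f\<^sup>k)' / f\<^sup>n\<close> has residue \<open>n\<close> at \<open>0\<close> if
  \<open>k = n\<close> and residue \<open>0\<close> otherwise, being then the derivative of a Laurent series. Since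
  \<open>h = t / f\<close>, the residue is the coefficient of \<open>t\<^bsup>n-1\<^esup>\<close> in \<open>(f\<^sup>k)' h\<^sup>n\<close>; working with powers
  of \<open>h\<close> keeps all exponents nonnegative.
\<close>

lemma lagrange_coefficient:
  fixes f h :: "'a :: field_char_0 fps"
  assumes fh: "f * h = fps_X" and h0: "fps_nth h 0 \<noteq> 0" and "n > 0"
  shows "fps_nth (fps_deriv (f ^ k) * h ^ n) (n - 1) = (if n = k then of_nat n else 0)"
proof -
  have f0: "fps_nth f 0 = 0"
    using arg_cong[OF fh, of "\<lambda>s. fps_nth s 0"] h0 by (simp add: fps_mult_nth)
  have product_rule: "fps_deriv (f ^ k) * h ^ n
      = fps_deriv (f ^ k * h ^ n) - of_nat n * (f ^ k * h ^ (n - 1)) * fps_deriv h"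
    by (simp add: fps_deriv_power fps_of_nat algebra_simps)
  consider "k < n" | "k = n" | "k > n" by linarith
  then show ?thesis
  proof cases
    case 1
    define m where "m = n - k"
    have m: "n = k + m" "m > 0" using 1 by (auto simp: m_def)
    have fh_m: "f ^ k * h ^ n = fps_X ^ k * h ^ m"
      by (simp add: m power_add fh[symmetric] power_mult_distrib)
    have "n - 1 = k + (m - 1)" using m by simp
    then have fh_m1: "f ^ k * h ^ (n - 1) = fps_X ^ k * h ^ (m - 1)"
      by (simp add: power_add fh[symmetric] power_mult_distrib)
    have deriv_hm: "of_nat m * (h ^ (m - 1) * fps_deriv h) = fps_deriv (h ^ m)"
      by (simp add: fps_deriv_power fps_of_nat algebra_simps)
    \<comment> \<open>Multiplying by \<open>m\<close> turns the factor \<open>m h\<^bsup>m-1\<^esup> h'\<close> into a derivative, so that both terms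
      become multiples of the coefficient of \<open>t\<^sup>m\<close> in \<open>h\<^sup>m\<close>.\<close>
    have "of_nat m * (fps_deriv (f ^ k) * h ^ n)
        = of_nat m * fps_deriv (fps_X ^ k * h ^ m)
          - of_nat n * (fps_X ^ k * fps_deriv (h ^ m))"
      unfolding product_rule fh_m fh_m1 deriv_hm[symmetric] by (simp only: algebra_simps)
    then have "fps_nth (fps_const (of_nat m) * (fps_deriv (f ^ k) * h ^ n)) (n - 1)
        = fps_nth (fps_const (of_nat m) * fps_deriv (fps_X ^ k * h ^ m)
          - fps_const (of_nat n) * (fps_X ^ k * fps_deriv (h ^ m))) (n - 1)"
      by (simp only: fps_of_nat)
    moreover have nth_deriv: "fps_nth (fps_deriv (fps_X ^ k * h ^ m)) (n - 1) = of_nat n * fps_nth (h ^ m) m"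
      using m by (simp add: fps_deriv_nth fps_X_power_mult_nth del: fps_deriv_mult)
    moreover have nth_shift: "fps_nth (fps_X ^ k * fps_deriv (h ^ m)) (n - 1) = of_nat m * fps_nth (h ^ m) m"
      using m by (auto simp: fps_deriv_nth fps_X_power_mult_nth)
    ultimately have "of_nat m * fps_nth (fps_deriv (f ^ k) * h ^ n) (n - 1)
        = of_nat m * (of_nat n * fps_nth (h ^ m) m)
          - of_nat n * (of_nat m * fps_nth (h ^ m) m)"
      by (simp only: fps_mult_left_const_nth fps_sub_nth nth_deriv nth_shift)
    also have "\<dots> = 0" by (simp add: mult.left_commute)
    finally show ?thesis using m 1 by simp
  next
    case 2
    have fh_n: "f ^ k * h ^ n = fps_X ^ n"
      using 2 by (simp add: fh[symmetric] power_mult_distrib)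
    have fh_n1: "f ^ k * h ^ (n - 1) = fps_X ^ (n - 1) * f"
      using 2 \<open>n > 0\<close> by (cases n) (simp_all add: fh[symmetric] power_mult_distrib)
    have "fps_deriv (f ^ k) * h ^ n
        = fps_deriv (fps_X ^ n) - fps_const (of_nat n) * (fps_X ^ (n - 1) * (f * fps_deriv h))"
      unfolding product_rule fh_n fh_n1 by (simp add: fps_of_nat mult.assoc)
    then show ?thesis
      using 2 \<open>n > 0\<close> f0 by (simp add: fps_X_power_mult_nth)
  next
    case 3
    have "f ^ (k - 1) = f ^ n * f ^ (k - 1 - n)"
      using 3 by (simp flip: power_add)
    then have "fps_deriv (f ^ k) * h ^ n
        = fps_X ^ n * (fps_const (of_nat k) * fps_deriv f * f ^ (k - 1 - n))"
      by (simp only: fps_deriv_power fh[symmetric] power_mult_distrib ac_simps)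
    then show ?thesis
      using 3 \<open>n > 0\<close> by (simp add: fps_X_power_mult_nth)
  qed
qed

lemma umbral_pairing_sum:
  "umbral_pairing f (\<Sum>i\<in>A. p i) = (\<Sum>i\<in>A. umbral_pairing f (p i))"
  by (induction A rule: infinite_finite_induct)
     (simp_all add: umbral_pairing_add umbral_pairing_def[of _ 0])

lemma umbral_pairing_pCons_0: "umbral_pairing f (pCons 0 p) = umbral_pairing (fps_deriv f) p"
proof -
  have "umbral_pairing f (pCons 0 p)
      = (\<Sum>k\<le>Suc (degree p). coeff (pCons 0 p) k * (fact k * fps_nth f k))"
    by (rule umbral_pairing_bound) (rule degree_pCons_le)
  also have "\<dots> = umbral_pairing (fps_deriv f) p"
    by (simp add: sum.atMost_Suc_shift umbral_pairing_def algebra_simps del: sum.atMost_Suc)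
  finally show ?thesis .
qed

text \<open>
  Multiplication by \<open>e\<^bsup>at\<^esup>\<close> is adjoint to the shift \<open>x \<mapsto> x + a\<close>; here the shift is applied
  to \<open>x\<^sup>m\<close>.
\<close>

lemma umbral_pairing_shifted_power:
  "umbral_pairing g ([:a, 1:] ^ m) = fact m * fps_nth (g * fps_exp a) m"
proof -
  have "umbral_pairing g ([:a, 1:] ^ m)
      = (\<Sum>k\<le>m. of_nat (m choose k) * a ^ (m - k) * (fact k * fps_nth g k))"
    by (subst umbral_pairing_bound[where N = m])
       (auto simp: degree_linear_power coeff_linear_poly_power)
  also have "\<dots> = (\<Sum>k\<le>m. fact m * (fps_nth g k * (a ^ (m - k) / fact (m - k))))"
    by (intro sum.cong) (auto simp: binomial_fact)
  also have "\<dots> = fact m * fps_nth (g * fps_exp a) m"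
    by (simp add: fps_mult_nth sum_distrib_left atMost_atLeast0)
  finally show ?thesis .
qed

text \<open>
  The sum over \<open>l\<close> is the image of \<open>x\<^sup>m\<close> under the operator \<open>(e\<^sup>t - c)\<^sup>n\<close>, whose adjoint is
  multiplication by this series.
\<close>

lemma umbral_pairing_binomial_shift_sum:
  "umbral_pairing g (\<Sum>l = 0..n. smult (of_nat (n choose l) * (- c) ^ (n - l)) ([:of_nat l, 1:] ^ m))
     = fact m * fps_nth (g * (fps_exp 1 - fps_const c) ^ n) m"
proof -
  have "(fps_exp 1 - fps_const c) ^ n = (fps_exp 1 + fps_const (- c)) ^ n"
    by (simp flip: fps_const_neg)
  also have "\<dots> = (\<Sum>l = 0..n. fps_const (of_nat (n choose l) * (- c) ^ (n - l)) * fps_exp (of_nat l))"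
    by (simp add: binomial_ring fps_exp_power_mult fps_const_power fps_of_nat[symmetric]
          atMost_atLeast0 ac_simps flip: fps_const_mult del: fps_const_neg)
  finally have binom: "(fps_exp 1 - fps_const c) ^ n
    = (\<Sum>l = 0..n. fps_const (of_nat (n choose l) * (- c) ^ (n - l)) * fps_exp (of_nat l))" .
  have "g * (fps_exp 1 - fps_const c) ^ n
      = (\<Sum>l = 0..n. fps_const (of_nat (n choose l) * (- c) ^ (n - l)) * (g * fps_exp (of_nat l)))"
    unfolding binom by (simp only: sum_distrib_left mult.left_commute)
  then have "fps_nth (g * (fps_exp 1 - fps_const c) ^ n) m
      = (\<Sum>l = 0..n. (of_nat (n choose l) * (- c) ^ (n - l)) * fps_nth (g * fps_exp (of_nat l)) m)"
    by (simp only: fps_sum_nth fps_mult_left_const_nth)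
  then show ?thesis
    unfolding umbral_pairing_sum umbral_pairing_smult umbral_pairing_shifted_power
    by (simp only: sum_distrib_left mult.left_commute)
qed

theorem theorem1:
  fixes lam :: complex and S :: "nat \<Rightarrow> complex poly" and n :: nat
  assumes "lam \<noteq> 1"
    and "associated_seq (fps_const (1 - lam) / (fps_exp 1 - fps_const lam) * fps_X) S"
  shows "S n = (if n = 0 then 1
    else smult (1 / (1 - lam) ^ n)
      ([:0, 1:] * (\<Sum>l = 0..n. smult (of_nat (n choose l) * (- lam) ^ (n - l))
                                 ([:of_nat l, 1:] ^ (n - 1)))))"
    (is "S n = ?T")
proof -
  define u where "u = fps_exp 1 - fps_const lam"
  define f where "f = fps_const (1 - lam) / u * fps_X"
  define h where "h = fps_const (1 / (1 - lam)) * u"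
  have u0: "fps_nth u 0 \<noteq> 0" using assms(1) by (simp add: u_def)
  have h0: "fps_nth h 0 \<noteq> 0" using u0 assms(1) by (simp add: h_def)
  have "f * h = fps_const (1 - lam) * fps_const (1 / (1 - lam)) * (inverse u * u) * fps_X"
    by (simp only: f_def h_def fps_divide_unit[OF u0] ac_simps)
  then have fh: "f * h = fps_X"
    using assms(1) by (simp add: inverse_mult_eq_1[OF u0])
  have S: "sheffer_seq 1 f S"
    using assms(2) by (simp add: associated_seq_def f_def u_def)
  have pairing_T: "umbral_pairing (1 * f ^ k) ?T = (if n = k then fact n else 0)" for k
  proof (cases "n = 0")
    case True
    then show ?thesis by (simp add: umbral_pairing_def f_def)
  next
    case False
    let ?Q = "\<Sum>l = 0..n. smult (of_nat (n choose l) * (- lam) ^ (n - l)) ([:of_nat l, 1:] ^ (n - 1))"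
    have "umbral_pairing (1 * f ^ k) ?T = 1 / (1 - lam) ^ n * umbral_pairing (fps_deriv (f ^ k)) ?Q"
      using False by (simp add: umbral_pairing_smult umbral_pairing_pCons_0)
    also have "\<dots> = fact (n - 1) * (1 / (1 - lam) ^ n * fps_nth (fps_deriv (f ^ k) * u ^ n) (n - 1))"
      unfolding umbral_pairing_binomial_shift_sum u_def by (simp only: ac_simps)
    also have "1 / (1 - lam) ^ n * fps_nth (fps_deriv (f ^ k) * u ^ n) (n - 1)
        = fps_nth (fps_const (1 / (1 - lam) ^ n) * (fps_deriv (f ^ k) * u ^ n)) (n - 1)"
      by (simp only: fps_mult_left_const_nth)
    also have "fps_const (1 / (1 - lam) ^ n) * (fps_deriv (f ^ k) * u ^ n) = fps_deriv (f ^ k) * h ^ n"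
      by (simp add: h_def power_mult_distrib fps_const_power power_one_over mult.left_commute)
    also have "fact (n - 1) * fps_nth (fps_deriv (f ^ k) * h ^ n) (n - 1)
        = (if n = k then fact n else 0)"
    proof -
      have "fact (n - 1) * of_nat n = (fact n :: complex)"
        using False fact_reduce[of n, where 'a = complex] by (simp only: mult.commute)
      then show ?thesis
        using False lagrange_coefficient[OF fh h0, of n k] by (cases "n = k") simp_all
    qed
    finally show ?thesis .
  qed
  have "S n - ?T = 0"
  proof (rule umbral_pairing_sheffer_eq_0)
    show "umbral_pairing (1 * f ^ k) (S n - ?T) = 0" for k
      using S pairing_T[of k] unfolding umbral_pairing_diff sheffer_seq_def by simp
  qed (use S in \<open>simp_all add: sheffer_seq_def\<close>)
  then show ?thesis by simp
qed

end
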